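(* Let $G$ be a simple connected graph on $n\geq 3$ vertices. Then $q_1(G)+q_2(G)\geq d_1(G)+d_2(G)+1$, with equality if and only if $G$ is the complete graph $K_3$ or the star $S_n$.
   Context: $Q(G)=D+A$ is the signless Laplacian of $G$ (degree diagonal matrix plus adjacency matrix), with eigenvalues $q_1(G)\geq q_2(G)\geq\cdots\geq q_n(G)$; $d_1(G)\geq d_2(G)\geq\cdots\geq d_n(G)$ is the non-increasing degree sequence of $G$. $S_n$ is the star $K_{1,n-1}$. *)

theory Defs
  imports
    "Graph_Theory.Graph_Theory"
    "Jordan_Normal_Form.Char_Poly"
begin

text \<open>
  Graphs are those of the \<^locale>\<open>graph\<close> locale: finite, loop-free, symmetric
  digraphs without parallel arcs. Each undirected edge is a pair of opposite
  arcs, so the degree of a vertex is its \<^const>\<open>out_degree\<close>, and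
  \<^const>\<open>arcs_ends\<close> is the adjacency relation.

  Matrices are indexed by \<open>{0..<n}\<close>, so they are taken with respect to an
  enumeration \<open>vs\<close> of the vertices, that is, a distinct list whose set is \<open>verts G\<close>.
\<close>

definition adjacency_mat :: "('a, 'b) pre_digraph \<Rightarrow> 'a list \<Rightarrow> real mat" where
  "adjacency_mat G vs = mat (length vs) (length vs)
     (\<lambda>(i, j). if (vs ! i, vs ! j) \<in> arcs_ends G then 1 else 0)"

definition degree_mat :: "('a, 'b) pre_digraph \<Rightarrow> 'a list \<Rightarrow> real mat" where
  "degree_mat G vs = mat_diag (length vs) (\<lambda>i. real (out_degree G (vs ! i)))"

definition signless_laplacian :: "('a, 'b) pre_digraph \<Rightarrow> 'a list \<Rightarrow> real mat" where
  "signless_laplacian G vs = degree_mat G vs + adjacency_mat G vs"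

text \<open>
  The \<open>k\<close>-th largest element, counted with multiplicity and starting from
  \<open>k = 1\<close>. It is meaningful only for \<open>1 \<le> k \<le> size M\<close>.
\<close>

definition kth_largest :: "'a :: linorder multiset \<Rightarrow> nat \<Rightarrow> 'a" where
  "kth_largest M k = rev (sorted_list_of_multiset M) ! (k - 1)"

text \<open>
  Eigenvalues are counted with algebraic multiplicity. As the matrix is real and
  symmetric, its characteristic polynomial splits over the reals, so its real
  roots are all its eigenvalues.
\<close>

definition signless_eigenvalue :: "('a, 'b) pre_digraph \<Rightarrow> 'a list \<Rightarrow> nat \<Rightarrow> real" where
  "signless_eigenvalue G vs k = kth_largest (proots (char_poly (signless_laplacian G vs))) k"

definition degree_seq :: "('a, 'b) pre_digraph \<Rightarrow> nat \<Rightarrow> nat" where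
  "degree_seq G k = kth_largest (image_mset (out_degree G) (mset_set (verts G))) k"

end

theory Submission
  imports Defs
begin

text \<open>
  The signless Laplacian is \<open>Q = B B\<^sup>T\<close> for the vertex-edge incidence matrix \<open>B\<close>, so by Ky Fan's
  principle \<open>|B x|\<^sup>2 / |x|\<^sup>2 + |B y|\<^sup>2 / |y|\<^sup>2 \<le> q\<^sub>1 + q\<^sub>2\<close> for orthogonal nonzero edge vectors
  \<open>x, y\<close>. Let \<open>u, v\<close> be vertices of largest and second largest degree, \<open>x\<close> the indicator of the
  edges at \<open>u\<close>, and \<open>y\<close> that of the edges at \<open>v\<close> avoiding \<open>u\<close>. The star with \<open>k\<close> edges has
  Rayleigh quotient \<open>k + 1\<close>, so the bound is \<open>d\<^sub>1 + d\<^sub>2 + 1\<close> if \<open>u, v\<close> are adjacent and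
  \<open>d\<^sub>1 + d\<^sub>2 + 2\<close> otherwise; if \<open>d\<^sub>2 = 1\<close>, then \<open>y = 0\<close>, and the graph is a star.

  In case of equality the pair \<open>(x, y)\<close> is a maximum, so \<open>B\<^sup>T B x\<close> and \<open>B\<^sup>T B y\<close> are orthogonal to
  every \<open>z\<close> orthogonal to \<open>x\<close> and \<open>y\<close>. Taking \<open>z\<close> to be a single edge missing \<open>u\<close> and \<open>v\<close>, or the
  difference of two edges at \<open>u\<close>, forces the graph to be a triangle. The spectra of triangles and
  stars are determined by their possible eigenvalues and the trace.
\<close>

section \<open>Spectral theorem for real symmetric matrices\<close>

lemma symmetric_mat_index:
  assumes "A \<in> carrier_mat n n" "A\<^sup>T = A" "i < n" "j < n"
  shows "A $$ (i, j) = A $$ (j, i)"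
  using assms by (metis carrier_matD(1,2) index_transpose_mat(1))

text \<open>A complex eigenvalue \<open>a\<close> exists because the characteristic polynomial
  splits over the complex numbers. Symmetry makes \<open>a\<close> real, hence a root of the real
  characteristic polynomial, and so a real eigenvector exists, which is then normalised.\<close>

lemma real_symmetric_eigenvector:
  fixes A :: "real mat"
  assumes A: "A \<in> carrier_mat n n" and sym: "A\<^sup>T = A" and n: "n > 0"
  obtains v a where "v \<in> carrier_vec n" "v \<bullet> v = 1" "A *\<^sub>v v = a \<cdot>\<^sub>v v"
proof -
  let ?h = complex_of_real
  let ?C = "map_mat ?h A"
  have C: "?C \<in> carrier_mat n n" using A by simp
  obtain as where as: "char_poly ?C = (\<Prod>a\<leftarrow>as. [:- a, 1:])" "length as = n"
    using char_poly_factorized[OF C] by blast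
  obtain a where "a \<in> set as" using n as(2) by (cases as) auto
  hence root: "poly (char_poly ?C) a = 0" using linear_poly_root as(1) by metis
  then obtain v where "eigenvector ?C v a"
    using eigenvalue_root_char_poly[OF C] unfolding eigenvalue_def by blast
  hence v: "v \<in> carrier_vec n" "v \<noteq> 0\<^sub>v n" "?C *\<^sub>v v = a \<cdot>\<^sub>v v"
    using C unfolding eigenvector_def by auto
  \<comment> \<open>The Hermitian form of \<open>A\<close> at \<open>v\<close>: it equals
    \<open>a\<close> times the positive number \<open>S\<close>, and by symmetry of \<open>A\<close>
    it is its own conjugate.\<close>
  define s where "s = (\<Sum>i<n. \<Sum>j<n. cnj (v $ i) * ?h (A $$ (i, j)) * v $ j)"
  have row: "(\<Sum>j<n. ?h (A $$ (i, j)) * v $ j) = a * v $ i" if "i < n" for i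
  proof -
    have "(?C *\<^sub>v v) $ i = (\<Sum>j<n. ?h (A $$ (i, j)) * v $ j)"
      using that A v(1) by (auto simp: scalar_prod_def lessThan_atLeast0 intro!: sum.cong)
    thus ?thesis using v that by simp
  qed
  define S where "S = (\<Sum>i<n. (cmod (v $ i))\<^sup>2)"
  have s: "s = a * ?h S"
    unfolding s_def S_def of_real_sum sum_distrib_left
    by (rule sum.cong, simp, subst mult.assoc, subst sum_distrib_left[symmetric])
      (simp add: row mult.assoc complex_norm_square[symmetric] mult.left_commute mult.commute[of "cnj _"])
  have "cnj s = (\<Sum>i<n. \<Sum>j<n. v $ i * ?h (A $$ (i, j)) * cnj (v $ j))"
    unfolding s_def by simp
  also have "\<dots> = (\<Sum>j<n. \<Sum>i<n. v $ i * ?h (A $$ (i, j)) * cnj (v $ j))"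
    by (rule sum.swap)
  also have "\<dots> = s"
    unfolding s_def using symmetric_mat_index[OF A sym] by (intro sum.cong) (auto simp: ac_simps)
  finally have cnj: "cnj s = s" .
  have "\<exists>i<n. v $ i \<noteq> 0" using v(1,2) by (metis carrier_vecD eq_vecI index_zero_vec)
  hence "S > 0" unfolding S_def by (auto intro!: sum_pos2)
  hence "cnj a = a" using cnj unfolding s by simp
  hence "a = ?h (Re a)" by (simp add: complex_eq_iff)
  hence "poly (map_poly ?h (char_poly A)) (?h (Re a)) = 0"
    using root of_real_hom.char_poly_hom[OF A, where 'a = complex] by metis
  hence "poly (char_poly A) (Re a) = 0" by simp
  then obtain w where "eigenvector A w (Re a)"
    using eigenvalue_root_char_poly[OF A] unfolding eigenvalue_def by blast
  hence w: "w \<in> carrier_vec n" "w \<noteq> 0\<^sub>v n" "A *\<^sub>v w = Re a \<cdot>\<^sub>v w"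
    using A unfolding eigenvector_def by auto
  have pos: "w \<bullet> w > 0" using w conjugate_square_greater_0_vec[OF w(1)]
    by (simp add: conjugate_vec_def vec_eq_iff)
  let ?c = "1 / sqrt (w \<bullet> w)"
  show ?thesis
  proof
    show "?c \<cdot>\<^sub>v w \<in> carrier_vec n" using w by simp
    show "(?c \<cdot>\<^sub>v w) \<bullet> (?c \<cdot>\<^sub>v w) = 1" using w pos by simp
    show "A *\<^sub>v (?c \<cdot>\<^sub>v w) = Re a \<cdot>\<^sub>v (?c \<cdot>\<^sub>v w)"
      using w A by (simp add: mult_mat_vec smult_smult_assoc mult.commute)
  qed
qed

text \<open>The Householder reflection along \<open>v - unit_vec (Suc n) 0\<close> exchanges the
  unit vector \<open>v\<close> with the first basis vector, so its first column is
  \<open>v\<close>.\<close>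

lemma householder_mat:
  fixes v :: "real vec"
  assumes v: "v \<in> carrier_vec (Suc n)" "v \<bullet> v = 1"
  obtains W where "W \<in> carrier_mat (Suc n) (Suc n)" "W\<^sup>T = W" "W * W = 1\<^sub>m (Suc n)" "col W 0 = v"
proof -
  define w where "w = v - unit_vec (Suc n) 0"
  have w: "w \<in> carrier_vec (Suc n)" unfolding w_def using v by simp
  \<comment> \<open>If \<open>v\<close> is already the first basis vector, then \<open>w\<close> is
    zero, division by zero gives \<open>c = 0\<close>, and \<open>?W\<close> is the identity, as
    desired.\<close>
  define c where "c = 2 / (w \<bullet> w)"
  let ?d = "\<lambda>i j :: nat. if i = j then 1 else 0 :: real"
  let ?W = "mat (Suc n) (Suc n) (\<lambda>(i, j). ?d i j - c * w $ i * w $ j)"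
  have w_ind: "w $ i = v $ i - ?d i 0" if "i < Suc n" for i
    using that v unfolding w_def by (auto simp: unit_vec_def)
  \<comment> \<open>Since \<open>v\<close> is a unit vector, both sides equal
    \<open>2 - 2 * v $ 0\<close>.\<close>
  have ww_v: "w \<bullet> w = - 2 * w $ 0"
  proof -
    have "w \<bullet> w = (\<Sum>i<Suc n. w $ i * w $ i)" using w by (simp add: scalar_prod_def lessThan_atLeast0)
    also have "\<dots> = (\<Sum>i<Suc n. v $ i * v $ i - 2 * (if i = 0 then v $ i else 0) + ?d i 0)"
      by (rule sum.cong) (auto simp: w_ind algebra_simps)
    also have "\<dots> = v \<bullet> v - 2 * v $ 0 + 1"
      using v by (simp add: scalar_prod_def lessThan_atLeast0 sum.distrib sum_subtractf sum_distrib_left[symmetric])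
    finally show ?thesis using v by (simp add: w_ind)
  qed
  have c: "c * (w \<bullet> w) * c = 2 * c" unfolding c_def by simp
  have wS: "(\<Sum>k<Suc n. w $ k * w $ k) = w \<bullet> w" using w by (simp add: scalar_prod_def lessThan_atLeast0)
  show ?thesis
  proof
    show "?W \<in> carrier_mat (Suc n) (Suc n)" by simp
    show "?W\<^sup>T = ?W" by (rule eq_matI) (auto simp: ac_simps)
    show "?W * ?W = 1\<^sub>m (Suc n)"
    proof (rule eq_matI)
      fix i j assume "i < dim_row (1\<^sub>m (Suc n) :: real mat)" "j < dim_col (1\<^sub>m (Suc n) :: real mat)"
      hence ij: "i < Suc n" "j < Suc n" by auto
      have "(?W * ?W) $$ (i, j) = (\<Sum>k<Suc n. (?d i k - c * w $ i * w $ k) * (?d k j - c * w $ k * w $ j))"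
        using ij by (simp add: scalar_prod_def lessThan_atLeast0 del: sum.lessThan_Suc sum.op_ivl_Suc)
      also have "\<dots> = (\<Sum>k<Suc n. ?d i k * ?d k j - (if k = i then c * w $ k * w $ j else 0)
          - (if k = j then c * w $ i * w $ k else 0) + c * c * w $ i * w $ j * (w $ k * w $ k))"
        by (rule sum.cong) (auto simp: algebra_simps)
      also have "\<dots> = ?d i j - c * w $ i * w $ j - c * w $ i * w $ j + c * c * w $ i * w $ j * (w \<bullet> w)"
      proof -
        have "(\<Sum>k<Suc n. ?d i k * ?d k j) = (\<Sum>k<Suc n. if k = i then ?d k j else 0)"
          by (rule sum.cong) auto
        hence "(\<Sum>k<Suc n. ?d i k * ?d k j) = ?d i j" using ij by (simp del: sum.lessThan_Suc)
        thus ?thesis using ij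
          by (simp add: sum.distrib sum_subtractf sum_distrib_left[symmetric] wS del: sum.lessThan_Suc)
      qed
      also have "c * c * w $ i * w $ j * (w \<bullet> w) = 2 * c * w $ i * w $ j"
        using c by (metis (no_types, opaque_lifting) mult.commute mult.left_commute)
      finally show "(?W * ?W) $$ (i, j) = 1\<^sub>m (Suc n) $$ (i, j)" using ij by simp
    qed auto
    show "col ?W 0 = v"
    proof (rule eq_vecI)
      fix i assume "i < dim_vec v"
      hence i: "i < Suc n" using v by simp
      have "c * w $ 0 * w $ i = - w $ i"
      proof (cases "w \<bullet> w = 0")
        case True
        hence "w = 0\<^sub>v (Suc n)" using conjugate_square_eq_0_vec[OF w] by (simp add: conjugate_vec_def vec_eq_iff)
        thus ?thesis using i by simp
      next
        case False
        thus ?thesis unfolding c_def ww_v by (simp add: field_simps)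
      qed
      thus "col ?W 0 $ i = v $ i" using i by (auto simp: w_ind algebra_simps)
    qed (use v in simp)
  qed
qed


text \<open>Deflation: conjugating by a reflection whose first column is an eigenvector clears the
  first column below the diagonal, symmetry clears the first row, and the induction hypothesis
  diagonalises the remaining block.\<close>

lemma real_spectral_theorem:
  fixes A :: "real mat"
  assumes "A \<in> carrier_mat n n" and "A\<^sup>T = A"
  shows "\<exists>P D. P \<in> carrier_mat n n \<and> D \<in> carrier_mat n n \<and> diagonal_mat D
    \<and> P\<^sup>T * P = 1\<^sub>m n \<and> A = P * D * P\<^sup>T"
  using assms
proof (induction n arbitrary: A)
  case 0
  show ?case by (rule exI[of _ "1\<^sub>m 0"], rule exI[of _ "1\<^sub>m 0"]) (use 0 in \<open>auto simp: diagonal_mat_def\<close>)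
next
  case (Suc n A)
  note A = Suc.prems(1) and sym = Suc.prems(2)
  obtain v a where v: "v \<in> carrier_vec (Suc n)" "v \<bullet> v = 1" "A *\<^sub>v v = a \<cdot>\<^sub>v v"
    using real_symmetric_eigenvector[OF A sym] by blast
  obtain W where W: "W \<in> carrier_mat (Suc n) (Suc n)" "W\<^sup>T = W" "W * W = 1\<^sub>m (Suc n)" "col W 0 = v"
    using householder_mat[OF v(1,2)] by blast
  define C where "C = W * A * W"
  have C: "C \<in> carrier_mat (Suc n) (Suc n)" unfolding C_def using W A by auto
  have C_sym: "C\<^sup>T = C"
    unfolding C_def using W A sym
    by (simp add: transpose_mult[of _ "Suc n" "Suc n" _ "Suc n"] assoc_mult_mat[of _ "Suc n" "Suc n" _ "Suc n" _ "Suc n"])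
  have A_eq: "A = W * C * W"
  proof -
    have "W * C * W = (W * W) * A * (W * W)" unfolding C_def using W(1) A
      by (simp add: assoc_mult_mat[of _ "Suc n" "Suc n" _ "Suc n" _ "Suc n"])
    thus ?thesis using W A by simp
  qed
  have "col C 0 = a \<cdot>\<^sub>v unit_vec (Suc n) 0"
  proof -
    have "col C 0 = (W * A) *\<^sub>v v"
      unfolding C_def W(4)[symmetric] using W(1) A by (intro col_mult2) auto
    also have "\<dots> = a \<cdot>\<^sub>v (W *\<^sub>v col W 0)"
      using W A v by (simp add: assoc_mult_mat_vec[of _ "Suc n" "Suc n"] mult_mat_vec)
    also have "W *\<^sub>v col W 0 = col (W * W) 0" using W(1) by (intro col_mult2[symmetric]) auto
    also have "\<dots> = unit_vec (Suc n) 0" unfolding W(3) by simp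
    finally show ?thesis .
  qed
  hence C0: "C $$ (i, 0) = (if i = 0 then a else 0)" if "i < Suc n" for i
    using that C by (metis carrier_matD(1,2) index_col index_smult_vec(1) index_unit_vec mult.right_neutral
        mult_zero_right zero_less_Suc dim_vec unit_vec_def index_vec index_unit_vec(3))
  define E where "E = mat n n (\<lambda>(i, j). C $$ (Suc i, Suc j))"
  have E: "E \<in> carrier_mat n n" unfolding E_def by simp
  have "E\<^sup>T = E" unfolding E_def
    by (rule eq_matI) (auto intro!: symmetric_mat_index[OF C C_sym])
  then obtain P D where PD: "P \<in> carrier_mat n n" "D \<in> carrier_mat n n" "diagonal_mat D"
    "P\<^sup>T * P = 1\<^sub>m n" "E = P * D * P\<^sup>T" using Suc.IH[OF E] by blast
  let ?blk = "\<lambda>x :: real mat. \<lambda>M. four_block_mat x (0\<^sub>m 1 n) (0\<^sub>m n 1) M"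
  let ?a = "a \<cdot>\<^sub>m 1\<^sub>m 1" and ?P = "?blk (1\<^sub>m 1) P"
  have C_blk: "C = ?blk ?a E"
  proof (rule eq_matI)
    fix i j assume "i < dim_row (?blk ?a E)" "j < dim_col (?blk ?a E)"
    hence ij: "i < Suc n" "j < Suc n" using E by auto
    have "C $$ (0, j) = C $$ (j, 0)" using symmetric_mat_index[OF C C_sym] ij by simp
    thus "C $$ (i, j) = ?blk ?a E $$ (i, j)"
      using ij E C0 by (cases i; cases j) (auto simp: E_def)
  qed (use C E in auto)
  have blk: "?blk x M \<in> carrier_mat (Suc n) (Suc n)" if "x \<in> carrier_mat 1 1" "M \<in> carrier_mat n n" for x M
    using that four_block_carrier_mat[OF that, of "0\<^sub>m 1 n" "0\<^sub>m n 1"] by simp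
  have blk_mult: "?blk x M * ?blk y N = ?blk (x * y) (M * N)"
    if "x \<in> carrier_mat 1 1" "M \<in> carrier_mat n n" "y \<in> carrier_mat 1 1" "N \<in> carrier_mat n n" for x y M N
    using that by (subst mult_four_block_mat[of _ 1 1 _ n _ n _ _ 1 _ n]) auto
  have blk_T: "?P\<^sup>T = ?blk (1\<^sub>m 1) P\<^sup>T"
    using PD by (subst transpose_four_block_mat[of _ 1 1 _ n _ n]) auto
  have PT: "P\<^sup>T \<in> carrier_mat n n" using PD by simp
  \<comment> \<open>The orthogonal matrix for \<open>A\<close>: the reflection followed by the
    diagonalising matrix of the smaller block, extended by a 1.\<close>
  define Q where "Q = W * ?P"
  have P': "?P \<in> carrier_mat (Suc n) (Suc n)" using PD by (intro blk) auto
  have Q: "Q \<in> carrier_mat (Suc n) (Suc n)" unfolding Q_def using W P' by auto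
  have QT: "Q\<^sup>T = ?P\<^sup>T * W" unfolding Q_def using W P'
    by (simp add: transpose_mult[of _ "Suc n" "Suc n" _ "Suc n"])
  have P'T: "?P\<^sup>T \<in> carrier_mat (Suc n) (Suc n)" using P' by (simp only: transpose_carrier_mat)
  have "Q\<^sup>T * Q = ?P\<^sup>T * (W * W) * ?P" unfolding QT unfolding Q_def using W(1) P' P'T
    by (simp add: assoc_mult_mat[of _ "Suc n" "Suc n" _ "Suc n" _ "Suc n"])
  also have "\<dots> = ?P\<^sup>T * ?P" unfolding W(3) right_mult_one_mat[OF P'T] ..
  also have "\<dots> = ?blk (1\<^sub>m 1) (1\<^sub>m n)" unfolding blk_T using PD PT by (subst blk_mult) auto
  also have "\<dots> = 1\<^sub>m (Suc n)" by (rule eq_matI) auto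
  finally have QQ: "Q\<^sup>T * Q = 1\<^sub>m (Suc n)" .
  have D': "?blk ?a D \<in> carrier_mat (Suc n) (Suc n)" using PD by (intro blk) auto
  have "C = ?P * ?blk ?a D * ?P\<^sup>T"
    unfolding C_blk PD(5) blk_T using PD PT
    by (subst blk_mult, simp, simp, simp, simp, subst blk_mult) auto
  hence "A = Q * ?blk ?a D * Q\<^sup>T"
    unfolding QT unfolding A_eq Q_def using W(1) P' P'T D'
    by (simp add: assoc_mult_mat[of _ "Suc n" "Suc n" _ "Suc n" _ "Suc n"])
  moreover have "diagonal_mat (?blk ?a D)"
    using PD(2,3) unfolding diagonal_mat_def by (auto simp: nat_less_iff) 
  ultimately show ?case using Q D' QQ by blast
qed

text \<open>The eigenvectors are the columns of the orthogonal matrix of the spectral theorem,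
  rearranged to follow a prescribed listing \<open>es\<close> of the eigenvalues;
  \<open>p i k\<close> is entry \<open>k\<close> of eigenvector \<open>i\<close>. Rows and columns
  are both orthonormal since a left inverse is also a right inverse.\<close>

lemma symmetric_mat_eigenbasis:
  fixes A :: "real mat"
  assumes A: "A \<in> carrier_mat n n" and sym: "A\<^sup>T = A" and es: "mset es = proots (char_poly A)"
  obtains p :: "nat \<Rightarrow> nat \<Rightarrow> real" where "length es = n"
    "\<And>i j. i < n \<Longrightarrow> j < n \<Longrightarrow> (\<Sum>k<n. p i k * p j k) = of_bool (i = j)"
    "\<And>k l. k < n \<Longrightarrow> l < n \<Longrightarrow> (\<Sum>i<n. p i k * p i l) = of_bool (k = l)"
    "\<And>i k. i < n \<Longrightarrow> k < n \<Longrightarrow> (\<Sum>l<n. A $$ (k, l) * p i l) = es ! i * p i k"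
proof -
  obtain P D where P: "P \<in> carrier_mat n n" and D: "D \<in> carrier_mat n n" "diagonal_mat D"
    and PP: "P\<^sup>T * P = 1\<^sub>m n" and A_eq: "A = P * D * P\<^sup>T"
    using real_spectral_theorem[OF A sym] by blast
  have PT: "P\<^sup>T \<in> carrier_mat n n" using P by simp
  have PP': "P * P\<^sup>T = 1\<^sub>m n" using mat_mult_left_right_inverse[OF PT P PP] .
  have "similar_mat A D" unfolding similar_mat_def
    by (rule exI, rule exI, rule similar_mat_witI[OF PP' PP A_eq A D(1) P PT])
  hence "char_poly A = char_poly D" by (rule char_poly_similar)
  also have "\<dots> = (\<Prod>a\<leftarrow>diag_mat D. [:- a, 1:])"
    using D by (intro char_poly_upper_triangular[OF D(1)] upper_triangularI) (auto simp: diagonal_mat_def)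
  finally have cp: "char_poly A = (\<Prod>a\<leftarrow>diag_mat D. [:- a, 1:])" .
  hence "proots (char_poly A) = mset (diag_mat D)"
  proof -
    have "proots (\<Prod>a\<leftarrow>xs. [:- a, 1:]) = mset xs" for xs :: "real list"
    proof (induction xs)
      case (Cons a xs)
      have "(\<Prod>a\<leftarrow>xs. [:- a, 1:]) \<noteq> 0" by (auto simp: prod_list_zero_iff)
      with Cons show ?case by (simp add: proots_mult del: mult_pCons_left)
    qed simp
    thus ?thesis unfolding cp by simp
  qed
  hence es_D: "mset es = mset (diag_mat D)" using es by simp
  have len: "length es = n" using mset_eq_length[OF es_D] D by (simp add: diag_mat_def)
  \<comment> \<open>The diagonal of \<open>D\<close> carries the eigenvalues in an arbitrary order;
    \<open>f i\<close> is the column belonging to \<open>es ! i\<close>.\<close>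
  obtain f where f: "f permutes {..<length (diag_mat D)}" "permute_list f (diag_mat D) = es"
    using mset_eq_permutation[OF es_D] by blast
  have f: "f permutes {..<n}" "permute_list f (diag_mat D) = es"
    using f D by (auto simp: diag_mat_def)
  have f_less: "f i < n" if "i < n" for i using permutes_in_image[OF f(1)] that by auto
  have es_f: "es ! i = D $$ (f i, f i)" if "i < n" for i
    using that f(2) f_less[OF that] f D(1) permute_list_nth[of f "diag_mat D" i]
    by (auto simp: diag_mat_def)
  have AP: "A * P = P * D"
  proof -
    have "A * P = P * D * (P\<^sup>T * P)" unfolding A_eq using P D PT
      by (simp add: assoc_mult_mat[of _ n n _ n _ n])
    thus ?thesis unfolding PP using P D by simp
  qed
  show ?thesis
  proof (rule that[of "\<lambda>i k. P $$ (k, f i)"])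
    show "length es = n" by fact
    fix i j assume ij: "i < n" "j < n"
    have "(\<Sum>k<n. P $$ (k, f i) * P $$ (k, f j)) = (P\<^sup>T * P) $$ (f i, f j)"
      using P f_less ij by (simp add: scalar_prod_def lessThan_atLeast0)
    also have "\<dots> = of_bool (i = j)" unfolding PP using f_less ij permutes_inj[OF f(1)]
      by (auto simp: inj_def)
    finally show "(\<Sum>k<n. P $$ (k, f i) * P $$ (k, f j)) = of_bool (i = j)" .
  next
    fix k l assume kl: "k < n" "l < n"
    have "(\<Sum>i<n. P $$ (k, f i) * P $$ (l, f i)) = (\<Sum>i<n. P $$ (k, i) * P $$ (l, i))"
      by (rule sum.permute[OF f(1), symmetric, unfolded comp_def])
    also have "\<dots> = (P * P\<^sup>T) $$ (k, l)"
      using P kl by (simp add: scalar_prod_def lessThan_atLeast0)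
    also have "\<dots> = of_bool (k = l)" unfolding PP' using kl by simp
    finally show "(\<Sum>i<n. P $$ (k, f i) * P $$ (l, f i)) = of_bool (k = l)" .
  next
    fix i k assume ik: "i < n" "k < n"
    have "(\<Sum>l<n. A $$ (k, l) * P $$ (l, f i)) = (A * P) $$ (k, f i)"
      using A P ik f_less by (simp add: scalar_prod_def lessThan_atLeast0)
    also have "\<dots> = (\<Sum>l<n. P $$ (k, l) * D $$ (l, f i))" unfolding AP
      using D P ik f_less by (simp add: scalar_prod_def lessThan_atLeast0)
    also have "\<dots> = (\<Sum>l<n. if l = f i then P $$ (k, f i) * D $$ (f i, f i) else 0)"
      using D ik f_less by (intro sum.cong) (auto simp: diagonal_mat_def)
    also have "\<dots> = es ! i * P $$ (k, f i)" using ik f_less es_f by simp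
    finally show "(\<Sum>l<n. A $$ (k, l) * P $$ (l, f i)) = es ! i * P $$ (k, f i)" .
  qed
qed

section \<open>Ky Fan's principle for two eigenvalues of a Gram matrix\<close>

text \<open>With \<open>y\<close> the projection of \<open>x\<close> onto the span of the
  \<open>r i\<close>, the claim is that the squared norm of \<open>x - y\<close> is nonnegative. The
  \<open>r i\<close> need not be normalised and may vanish, a zero vector contributing 0 because
  division by zero gives 0.\<close>

lemma bessel_inequality:
  fixes x :: "'e \<Rightarrow> real"
  assumes fin: "finite I" "finite E"
    and orth: "\<And>i j. i \<in> I \<Longrightarrow> j \<in> I \<Longrightarrow> i \<noteq> j \<Longrightarrow> (\<Sum>e\<in>E. r i e * r j e) = 0"
  shows "(\<Sum>i\<in>I. (\<Sum>e\<in>E. x e * r i e)\<^sup>2 / (\<Sum>e\<in>E. (r i e)\<^sup>2)) \<le> (\<Sum>e\<in>E. (x e)\<^sup>2)"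
proof -
  define s where "s i = (\<Sum>e\<in>E. x e * r i e)" for i
  define m where "m i = (\<Sum>e\<in>E. (r i e)\<^sup>2)" for i
  define c where "c i = s i / m i" for i
  define y where "y e = (\<Sum>i\<in>I. c i * r i e)" for e
  have xy: "(\<Sum>e\<in>E. x e * y e) = (\<Sum>i\<in>I. c i * s i)"
    unfolding y_def s_def sum_distrib_left by (subst sum.swap) (simp add: ac_simps)
  have "(\<Sum>e\<in>E. y e * y e) = (\<Sum>e\<in>E. \<Sum>i\<in>I. c i * (r i e * y e))"
    by (subst (1) y_def) (simp add: sum_distrib_right mult.assoc)
  also have "\<dots> = (\<Sum>i\<in>I. c i * (\<Sum>e\<in>E. r i e * y e))"
    by (subst sum.swap) (simp add: sum_distrib_left)
  also have "\<dots> = (\<Sum>i\<in>I. c i * (c i * m i))"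
  proof (rule sum.cong[OF refl])
    fix i assume i: "i \<in> I"
    have "(\<Sum>e\<in>E. r i e * y e) = (\<Sum>j\<in>I. c j * (\<Sum>e\<in>E. r i e * r j e))"
      unfolding y_def sum_distrib_left by (subst sum.swap) (simp add: ac_simps)
    also have "\<dots> = (\<Sum>j\<in>I. if j = i then c i * m i else 0)"
      using orth[OF i] by (intro sum.cong) (auto simp: m_def power2_eq_square)
    finally show "c i * (\<Sum>e\<in>E. r i e * y e) = c i * (c i * m i)" using i fin by simp
  qed
  \<comment> \<open>If \<open>m i = 0\<close>, then \<open>c i = 0\<close>, so both summands
    vanish.\<close>
  also have "\<dots> = (\<Sum>i\<in>I. c i * s i)" unfolding c_def by (rule sum.cong) auto
  finally have yy: "(\<Sum>e\<in>E. y e * y e) = (\<Sum>i\<in>I. c i * s i)" .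
  have "0 \<le> (\<Sum>e\<in>E. (x e - y e)\<^sup>2)" by (simp add: sum_nonneg)
  also have "\<dots> = (\<Sum>e\<in>E. (x e)\<^sup>2 - 2 * (x e * y e) + y e * y e)"
    by (rule sum.cong) (auto simp: power2_eq_square algebra_simps)
  also have "\<dots> = (\<Sum>e\<in>E. (x e)\<^sup>2) - (\<Sum>i\<in>I. c i * s i)"
    by (simp add: sum.distrib sum_subtractf sum_distrib_left[symmetric] xy yy)
  finally show ?thesis unfolding c_def s_def m_def by (simp add: power2_eq_square)
qed

text \<open>The \<open>p i\<close> form an orthonormal eigenbasis of \<open>B B^T\<close>, with
  eigenvalues in decreasing order and counted from 0. Vectors are functions on \<open>V\<close> and
  \<open>E\<close>; below, \<open>img x\<close> is \<open>B x\<close> and \<open>dual i\<close> is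
  \<open>B^T p_i\<close>.\<close>

locale gram_eigenbasis =
  fixes V :: "'a set" and E :: "'e set" and B :: "'a \<Rightarrow> 'e \<Rightarrow> real"
    and n :: nat and q :: "nat \<Rightarrow> real" and p :: "nat \<Rightarrow> 'a \<Rightarrow> real"
  assumes finite_V: "finite V" and finite_E: "finite E" and n_ge_2: "2 \<le> n"
    and decreasing: "i \<le> j \<Longrightarrow> j < n \<Longrightarrow> q j \<le> q i"
    and orthonormal: "i < n \<Longrightarrow> j < n \<Longrightarrow> (\<Sum>v\<in>V. p i v * p j v) = of_bool (i = j)"
    and complete: "v \<in> V \<Longrightarrow> w \<in> V \<Longrightarrow> (\<Sum>i<n. p i v * p i w) = of_bool (v = w)"
    and eigen: "i < n \<Longrightarrow> v \<in> V \<Longrightarrow> (\<Sum>e\<in>E. B v e * (\<Sum>w\<in>V. B w e * p i w)) = q i * p i v"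
begin

definition img :: "('e \<Rightarrow> real) \<Rightarrow> 'a \<Rightarrow> real" where
  "img x v = (\<Sum>e\<in>E. B v e * x e)"

definition dual :: "nat \<Rightarrow> 'e \<Rightarrow> real" where
  "dual i e = (\<Sum>v\<in>V. B v e * p i v)"

lemma img_adjoint: "(\<Sum>v\<in>V. img x v * p i v) = (\<Sum>e\<in>E. x e * dual i e)"
  unfolding img_def dual_def sum_distrib_right sum_distrib_left
  by (subst sum.swap) (simp add: ac_simps)

text \<open>Moving \<open>B\<close> across the inner product turns the left side into the product of
  \<open>B B^T p_i\<close> with \<open>p_j\<close>.\<close>

lemma dual_orthogonal:
  assumes "i < n" "j < n"
  shows "(\<Sum>e\<in>E. dual i e * dual j e) = (if i = j then q i else 0)"
proof -
  have "(\<Sum>e\<in>E. dual i e * dual j e) = (\<Sum>v\<in>V. img (dual i) v * p j v)"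
    by (rule img_adjoint[symmetric])
  also have "\<dots> = (\<Sum>v\<in>V. q i * (p i v * p j v))"
    using eigen[OF assms(1)] by (intro sum.cong) (auto simp: img_def dual_def)
  also have "\<dots> = (if i = j then q i else 0)"
    unfolding sum_distrib_left[symmetric] using orthonormal[OF assms] by simp
  finally show ?thesis .
qed

lemma sum_dual_sq: "i < n \<Longrightarrow> (\<Sum>e\<in>E. (dual i e)\<^sup>2) = q i"
  using dual_orthogonal[of i i] by (simp add: power2_eq_square)

lemma eigenvalue_nonneg: "i < n \<Longrightarrow> 0 \<le> q i"
  using sum_dual_sq by (metis sum_nonneg zero_le_power2)

lemma eigenvector_nonzero:
  assumes "i < n" shows "\<exists>v\<in>V. p i v \<noteq> 0"
proof (rule ccontr)
  assume "\<not> ?thesis"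
  hence "(\<Sum>v\<in>V. p i v * p i v) = 0" by (intro sum.neutral) auto
  thus False using orthonormal[OF assms assms] by simp
qed

lemma parseval: "(\<Sum>v\<in>V. (g v)\<^sup>2) = (\<Sum>i<n. (\<Sum>v\<in>V. g v * p i v)\<^sup>2)"
proof -
  have "(\<Sum>i<n. (\<Sum>v\<in>V. g v * p i v)\<^sup>2)
      = (\<Sum>i<n. \<Sum>v\<in>V. \<Sum>w\<in>V. (g v * g w) * (p i v * p i w))"
    by (simp add: power2_eq_square sum_product ac_simps)
  also have "\<dots> = (\<Sum>v\<in>V. \<Sum>w\<in>V. \<Sum>i<n. (g v * g w) * (p i v * p i w))"
    by (subst sum.swap, rule sum.cong[OF refl], rule sum.swap)
  also have "\<dots> = (\<Sum>v\<in>V. \<Sum>w\<in>V. if w = v then g v * g v else 0)"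
    using complete by (intro sum.cong refl) (auto simp: sum_distrib_left[symmetric])
  also have "\<dots> = (\<Sum>v\<in>V. (g v)\<^sup>2)" using finite_V by (simp add: power2_eq_square)
  finally show ?thesis ..
qed

text \<open>The trace of \<open>B B^T\<close> as the squared Frobenius norm of \<open>B\<close>:
  each \<open>q i\<close> is the squared norm of \<open>dual i\<close>, and Parseval applies to each
  column of \<open>B\<close>.\<close>

lemma sum_eigenvalues: "(\<Sum>i<n. q i) = (\<Sum>v\<in>V. \<Sum>e\<in>E. (B v e)\<^sup>2)"
proof -
  have "(\<Sum>i<n. q i) = (\<Sum>i<n. \<Sum>e\<in>E. (dual i e)\<^sup>2)" using sum_dual_sq by simp
  also have "\<dots> = (\<Sum>e\<in>E. \<Sum>i<n. (\<Sum>v\<in>V. B v e * p i v)\<^sup>2)"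
    unfolding dual_def by (rule sum.swap)
  also have "\<dots> = (\<Sum>v\<in>V. \<Sum>e\<in>E. (B v e)\<^sup>2)"
    unfolding parseval[symmetric] by (rule sum.swap)
  finally show ?thesis .
qed

text \<open>In the eigenbasis the left side becomes a sum of \<open>q i * t i\<close> with weights
  \<open>t i\<close> between 0 and 1 and total at most 2. Such a sum is largest when the weights sit
  on the two largest eigenvalues.\<close>

lemma two_largest_ge:
  assumes xy: "(\<Sum>e\<in>E. x e * y e) = 0"
    and x: "(\<Sum>e\<in>E. (x e)\<^sup>2) > 0" and y: "(\<Sum>e\<in>E. (y e)\<^sup>2) > 0"
  shows "(\<Sum>v\<in>V. (img x v)\<^sup>2) / (\<Sum>e\<in>E. (x e)\<^sup>2) + (\<Sum>v\<in>V. (img y v)\<^sup>2) / (\<Sum>e\<in>E. (y e)\<^sup>2) \<le> q 0 + q 1"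
proof -
  define X where "X = (\<Sum>e\<in>E. (x e)\<^sup>2)"
  define Y where "Y = (\<Sum>e\<in>E. (y e)\<^sup>2)"
  define a where "a i = (\<Sum>e\<in>E. x e * dual i e)\<^sup>2 / X" for i
  define b where "b i = (\<Sum>e\<in>E. y e * dual i e)\<^sup>2 / Y" for i
  define t where "t i = (a i + b i) / q i" for i
  have pos: "X > 0" "Y > 0" using x y unfolding X_def Y_def by auto
  \<comment> \<open>Bessel for the vector \<open>dual i\<close> against the orthogonal pair
    \<open>x\<close>, \<open>y\<close>.\<close>
  have s_le: "a i + b i \<le> q i" if i: "i < n" for i
    using bessel_inequality[of "{True, False}" E "\<lambda>b. if b then x else y" "dual i"] xy finite_E sum_dual_sq[OF i]
    by (simp add: a_def b_def X_def Y_def mult.commute)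
  have nonneg: "a i + b i \<ge> 0" for i
    unfolding a_def b_def using pos by (intro add_nonneg_nonneg divide_nonneg_pos) auto
  \<comment> \<open>The last equation survives \<open>q i = 0\<close>, since
    \<open>a i + b i\<close> is then squeezed to 0.\<close>
  have t: "0 \<le> t i" "t i \<le> 1" "q i * t i = a i + b i" if "i < n" for i
    using nonneg[of i] s_le[OF that] eigenvalue_nonneg[OF that] unfolding t_def
    by (auto simp: divide_le_eq)
  \<comment> \<open>Bessel with the roles exchanged: \<open>z\<close> against the orthogonal family
    \<open>dual\<close>. It bounds the total weight.\<close>
  have bessel: "(\<Sum>i<n. (\<Sum>e\<in>E. z e * dual i e)\<^sup>2 / q i) \<le> (\<Sum>e\<in>E. (z e)\<^sup>2)" for z
    using bessel_inequality[of "{..<n}" E dual z] finite_E dual_orthogonal by (simp add: sum_dual_sq)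
  have "(\<Sum>i<n. a i / q i) = (\<Sum>i<n. (\<Sum>e\<in>E. x e * dual i e)\<^sup>2 / q i) / X"
    unfolding a_def sum_divide_distrib by (simp add: mult.commute)
  also have "\<dots> \<le> 1" using bessel[of x] pos unfolding X_def[symmetric] by (simp add: divide_le_eq)
  moreover have "(\<Sum>i<n. b i / q i) = (\<Sum>i<n. (\<Sum>e\<in>E. y e * dual i e)\<^sup>2 / q i) / Y"
    unfolding b_def sum_divide_distrib by (simp add: mult.commute)
  moreover have "\<dots> \<le> 1" using bessel[of y] pos unfolding Y_def[symmetric] by (simp add: divide_le_eq)
  ultimately have t_sum: "(\<Sum>i<n. t i) \<le> 2"
    unfolding t_def add_divide_distrib sum.distrib by linarith
  have n01: "0 < n" "1 < n" using n_ge_2 by auto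
  \<comment> \<open>After subtracting \<open>q 1\<close>, only the coefficient at index 0 can be
    positive, and there the weight is at most 1.\<close>
  have "(\<Sum>i<n. (q i - q 1) * t i) \<le> (\<Sum>i<n. if i = 0 then q 0 - q 1 else 0)"
  proof (rule sum_mono)
    fix i assume "i \<in> {..<n}"
    hence i: "i < n" by simp
    show "(q i - q 1) * t i \<le> (if i = 0 then q 0 - q 1 else 0)"
    proof (cases "i = 0")
      case True
      thus ?thesis using t[OF i] decreasing[of 0 1] n01 by (simp add: mult_left_le)
    next
      case False
      thus ?thesis using t[OF i] decreasing[of 1 i] i by (simp add: mult_nonpos_nonneg)
    qed
  qed
  also have "\<dots> = q 0 - q 1" using n01 by simp
  finally have "(\<Sum>i<n. a i + b i) \<le> q 0 - q 1 + q 1 * (\<Sum>i<n. t i)"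
    using t by (simp add: left_diff_distrib sum_subtractf sum_distrib_left)
  also have "\<dots> \<le> q 0 - q 1 + q 1 * 2"
    using t_sum eigenvalue_nonneg[OF n01(2)] by (intro add_left_mono mult_left_mono) auto
  finally have "(\<Sum>i<n. a i) + (\<Sum>i<n. b i) \<le> q 0 + q 1" by (simp add: sum.distrib)
  moreover have "(\<Sum>v\<in>V. (img z v)\<^sup>2) = (\<Sum>i<n. (\<Sum>e\<in>E. z e * dual i e)\<^sup>2)" for z
    unfolding parseval img_adjoint ..
  ultimately show ?thesis unfolding a_def b_def X_def Y_def by (simp add: sum_divide_distrib)
qed

text \<open>The first-order condition obtained by perturbing \<open>x\<close> to \<open>x + t z\<close>.\<close>

lemma two_largest_eq_stationary:
  assumes xy: "(\<Sum>e\<in>E. x e * y e) = 0"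
    and x: "(\<Sum>e\<in>E. (x e)\<^sup>2) > 0" and y: "(\<Sum>e\<in>E. (y e)\<^sup>2) > 0"
    and eq: "(\<Sum>v\<in>V. (img x v)\<^sup>2) / (\<Sum>e\<in>E. (x e)\<^sup>2) + (\<Sum>v\<in>V. (img y v)\<^sup>2) / (\<Sum>e\<in>E. (y e)\<^sup>2) = q 0 + q 1"
    and zx: "(\<Sum>e\<in>E. z e * x e) = 0" and zy: "(\<Sum>e\<in>E. z e * y e) = 0"
  shows "(\<Sum>v\<in>V. img z v * img x v) = 0"
proof (rule ccontr)
  define X where "X = (\<Sum>e\<in>E. (x e)\<^sup>2)"
  define Z where "Z = (\<Sum>e\<in>E. (z e)\<^sup>2)"
  define a where "a = (\<Sum>v\<in>V. (img x v)\<^sup>2)"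
  define b where "b = (\<Sum>v\<in>V. img z v * img x v)"
  define c where "c = (\<Sum>v\<in>V. (img z v)\<^sup>2)"
  assume "(\<Sum>v\<in>V. img z v * img x v) \<noteq> 0"
  hence b: "b \<noteq> 0" unfolding b_def .
  have pos: "X > 0" "Z \<ge> 0" "c \<ge> 0" "a \<ge> 0" using x unfolding X_def Z_def c_def a_def by (auto intro: sum_nonneg)
  \<comment> \<open>The perturbed vector stays orthogonal to \<open>y\<close>, so its Rayleigh
    quotient cannot exceed that of \<open>x\<close>; clearing denominators leaves a term linear in
    \<open>t\<close> against a quadratic one.\<close>
  have perturbed: "2 * t * b \<le> t\<^sup>2 * (a / X * Z)" for t
  proof -
    define x' where "x' e = x e + t * z e" for e
    have "(\<Sum>e\<in>E. (x' e)\<^sup>2) = (\<Sum>e\<in>E. (x e)\<^sup>2 + 2 * t * (z e * x e) + t\<^sup>2 * (z e)\<^sup>2)"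
      unfolding x'_def by (rule sum.cong) (auto simp: power2_eq_square algebra_simps)
    hence X': "(\<Sum>e\<in>E. (x' e)\<^sup>2) = X + t\<^sup>2 * Z"
      using zx by (simp add: sum.distrib sum_distrib_left[symmetric] X_def Z_def)
    have "img x' v = img x v + t * img z v" for v
      unfolding img_def x'_def by (simp add: distrib_left sum.distrib sum_distrib_left ac_simps)
    hence "(\<Sum>v\<in>V. (img x' v)\<^sup>2) = (\<Sum>v\<in>V. (img x v)\<^sup>2 + 2 * t * (img z v * img x v) + t\<^sup>2 * (img z v)\<^sup>2)"
      by (intro sum.cong) (auto simp: power2_eq_square algebra_simps)
    hence I': "(\<Sum>v\<in>V. (img x' v)\<^sup>2) = a + 2 * t * b + t\<^sup>2 * c"
      by (simp add: sum.distrib sum_distrib_left[symmetric] a_def b_def c_def)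
    have X'_pos: "X + t\<^sup>2 * Z > 0" using pos by (intro add_pos_nonneg) auto
    have "(\<Sum>e\<in>E. x' e * y e) = 0"
      using xy zy unfolding x'_def
      by (simp add: distrib_right sum.distrib mult.assoc sum_distrib_left[symmetric])
    from two_largest_ge[OF this _ y] X'_pos eq
    have "(a + 2 * t * b + t\<^sup>2 * c) / (X + t\<^sup>2 * Z) \<le> a / X"
      unfolding X' I' a_def X_def by simp
    hence "a + 2 * t * b + t\<^sup>2 * c \<le> a / X * (X + t\<^sup>2 * Z)"
      using X'_pos by (simp add: pos_divide_le_eq)
    also have "\<dots> = a + t\<^sup>2 * (a / X * Z)" using pos by (simp add: field_simps)
    finally show ?thesis using pos(3) by (smt (verit) mult_nonneg_nonneg zero_le_power2)
  qed
  define K where "K = a / X * Z"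
  have "K \<ge> 0" unfolding K_def using pos by simp
  \<comment> \<open>This \<open>t\<close> is small enough for the linear term to win; adding 1 to
    \<open>K\<close> keeps the denominator positive.\<close>
  have "2 * (b / (K + 1)) * b \<le> (b / (K + 1))\<^sup>2 * K" using perturbed unfolding K_def by blast
  moreover have "b = (b / (K + 1)) * (K + 1)" using \<open>K \<ge> 0\<close> by simp
  ultimately have "(b / (K + 1))\<^sup>2 * (2 * (K + 1)) \<le> (b / (K + 1))\<^sup>2 * K"
    by (metis (no_types, opaque_lifting) mult.assoc mult.commute power2_eq_square)
  thus False using b \<open>K \<ge> 0\<close> by (simp add: mult_le_cancel_left)
qed

text \<open>Stationarity in the direction of the difference of the unit vectors at \<open>e\<close>
  and \<open>e'\<close>, which is orthogonal to \<open>x\<close> and \<open>y\<close> because these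
  agree on the two edges.\<close>

lemma two_largest_eq_gram_cong:
  assumes xy: "(\<Sum>e\<in>E. x e * y e) = 0"
    and x: "(\<Sum>e\<in>E. (x e)\<^sup>2) > 0" and y: "(\<Sum>e\<in>E. (y e)\<^sup>2) > 0"
    and eq: "(\<Sum>v\<in>V. (img x v)\<^sup>2) / (\<Sum>e\<in>E. (x e)\<^sup>2) + (\<Sum>v\<in>V. (img y v)\<^sup>2) / (\<Sum>e\<in>E. (y e)\<^sup>2) = q 0 + q 1"
    and e: "e \<in> E" "e' \<in> E" "x e = x e'" "y e = y e'"
  shows "(\<Sum>v\<in>V. B v e * img x v) = (\<Sum>v\<in>V. B v e' * img x v)"
proof -
  define z :: "'e \<Rightarrow> real" where "z d = of_bool (d = e) - of_bool (d = e')" for d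
  have z: "(\<Sum>d\<in>E. z d * g d) = g e - g e'" for g
    using e finite_E unfolding z_def by (simp add: left_diff_distrib sum_subtractf)
  have "img z v = B v e - B v e'" for v
    using z[of "B v"] unfolding img_def by (simp add: mult.commute)
  moreover have "(\<Sum>v\<in>V. img z v * img x v) = 0"
    using e by (intro two_largest_eq_stationary[OF xy x y eq]) (auto simp: z)
  ultimately show ?thesis by (simp add: left_diff_distrib sum_subtractf)
qed

text \<open>Stationarity in the direction of the unit vector at \<open>e\<close>.\<close>

lemma two_largest_eq_gram_zero:
  assumes xy: "(\<Sum>e\<in>E. x e * y e) = 0"
    and x: "(\<Sum>e\<in>E. (x e)\<^sup>2) > 0" and y: "(\<Sum>e\<in>E. (y e)\<^sup>2) > 0"
    and eq: "(\<Sum>v\<in>V. (img x v)\<^sup>2) / (\<Sum>e\<in>E. (x e)\<^sup>2) + (\<Sum>v\<in>V. (img y v)\<^sup>2) / (\<Sum>e\<in>E. (y e)\<^sup>2) = q 0 + q 1"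
    and e: "e \<in> E" "x e = 0" "y e = 0"
  shows "(\<Sum>v\<in>V. B v e * img x v) = 0"
proof -
  define z :: "'e \<Rightarrow> real" where "z d = of_bool (d = e)" for d
  have z: "(\<Sum>d\<in>E. z d * g d) = g e" for g
    using e finite_E unfolding z_def by simp
  have "img z v = B v e" for v
    using z[of "B v"] unfolding img_def by (simp add: mult.commute)
  moreover have "(\<Sum>v\<in>V. img z v * img x v) = 0"
    using e by (intro two_largest_eq_stationary[OF xy x y eq]) (auto simp: z)
  ultimately show ?thesis by simp
qed

end

section \<open>Connected graphs as adjacency relations\<close>

text \<open>Opposite arcs collapse to one two-element set, so that the incidence matrix has a single
  column per undirected edge.\<close>

definition edge_sets :: "('a \<times> 'a) set \<Rightarrow> 'a set set" where
  "edge_sets R = (\<lambda>(v, w). {v, w}) ` R"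

text \<open>Connectedness is stated as the absence of proper nonempty sets closed under adjacency,
  the form in which it identifies stars and triangles.\<close>

locale connected_adjacency =
  fixes V :: "'a set" and R :: "('a \<times> 'a) set"
  assumes finite_verts: "finite V" and adj_verts: "R \<subseteq> V \<times> V"
    and adj_sym: "(v, w) \<in> R \<Longrightarrow> (w, v) \<in> R" and adj_irrefl: "(v, v) \<notin> R"
    and closed_eq_verts: "S \<subseteq> V \<Longrightarrow> S \<noteq> {} \<Longrightarrow> (\<And>v w. v \<in> S \<Longrightarrow> (v, w) \<in> R \<Longrightarrow> w \<in> S) \<Longrightarrow> S = V"
begin

abbreviation nbs :: "'a \<Rightarrow> 'a set" where
  "nbs v \<equiv> R `` {v}"

abbreviation deg :: "'a \<Rightarrow> nat" where
  "deg v \<equiv> card (nbs v)"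

lemma finite_nbs: "finite (nbs v)"
  using adj_verts by (rule_tac finite_subset[OF _ finite_verts]) auto

lemma finite_edge_sets: "finite (edge_sets R)"
  unfolding edge_sets_def using adj_verts finite_verts by (metis finite_SigmaI finite_imageI finite_subset)

lemma edge_setsI: "(v, w) \<in> R \<Longrightarrow> {v, w} \<in> edge_sets R"
  unfolding edge_sets_def by force

lemma sum_incident_edges:
  "(\<Sum>e\<in>edge_sets R. of_bool (v \<in> e) * f e) = (\<Sum>w\<in>nbs v. f {v, w} :: real)"
proof -
  have "(\<Sum>e\<in>edge_sets R. of_bool (v \<in> e) * f e) = (\<Sum>e\<in>{e \<in> edge_sets R. v \<in> e}. f e)"
    by (rule sum.mono_neutral_cong_right) (use finite_edge_sets in auto)
  also have "{e \<in> edge_sets R. v \<in> e} = (\<lambda>w. {v, w}) ` nbs v"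
    unfolding edge_sets_def using adj_sym by (auto simp: image_iff insert_commute)
  also have "(\<Sum>e\<in>(\<lambda>w. {v, w}) ` nbs v. f e) = (\<Sum>w\<in>nbs v. f {v, w})"
    by (subst sum.reindex) (auto simp: inj_on_def doubleton_eq_iff)
  finally show ?thesis .
qed

lemma sum_edge_ends:
  assumes "(v, w) \<in> R"
  shows "(\<Sum>x\<in>V. of_bool (x \<in> {v, w}) * f x) = (f v + f w :: real)"
proof -
  have "(\<Sum>x\<in>V. of_bool (x \<in> {v, w}) * f x) = (\<Sum>x\<in>{v, w}. f x)"
    using assms adj_verts finite_verts by (intro sum.mono_neutral_cong_right) auto
  moreover have "v \<noteq> w" using assms adj_irrefl by auto
  ultimately show ?thesis by simp
qed

text \<open>This is the identity \<open>B B^T = D + A\<close> applied to \<open>f\<close>: the terms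
  \<open>f v\<close> add up to the degree part, the terms \<open>f w\<close> to the adjacency
  part.\<close>

lemma gram_edge_sets:
  "(\<Sum>e\<in>edge_sets R. of_bool (v \<in> e) * (\<Sum>w\<in>V. of_bool (w \<in> e) * f w))
    = (\<Sum>w\<in>nbs v. f v + f w :: real)"
  unfolding sum_incident_edges by (intro sum.cong refl sum_edge_ends) auto

lemma nbs_nonempty:
  assumes "v \<in> V" "card V \<ge> 2" shows "nbs v \<noteq> {}"
proof
  assume "nbs v = {}"
  hence "{v} = V" using assms by (intro closed_eq_verts) auto
  thus False using assms by (metis card.empty card_insert_disjoint empty_iff finite.emptyI not_less_eq_eq numeral_2_eq_2 order_refl)
qed

text \<open>If the only neighbour of a vertex \<open>w\<close> were some \<open>t\<close> other than
  \<open>c\<close>, then \<open>t\<close> would have degree 1 too, and \<open>{w, t}\<close> would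
  be closed under adjacency but miss \<open>c\<close>.\<close>

lemma all_other_deg_1_imp_star:
  assumes c: "c \<in> V" and deg: "\<And>w. w \<in> V \<Longrightarrow> w \<noteq> c \<Longrightarrow> deg w = 1"
  shows "R = {c} \<times> (V - {c}) \<union> (V - {c}) \<times> {c}"
proof -
  have nb: "nbs w = {c}" if w: "w \<in> V" "w \<noteq> c" for w
  proof -
    obtain t where t: "nbs w = {t}" using deg[OF w] card_1_singletonE by blast
    have "t = c"
    proof (rule ccontr)
      assume "t \<noteq> c"
      have "t \<in> V" "w \<in> nbs t" using t adj_verts adj_sym by auto
      moreover obtain s where "nbs t = {s}" using deg[OF \<open>t \<in> V\<close> \<open>t \<noteq> c\<close>] card_1_singletonE by blast
      ultimately have "nbs t = {w}" by auto
      hence "{w, t} = V" using t w \<open>t \<in> V\<close> by (intro closed_eq_verts) auto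
      thus False using c w \<open>t \<noteq> c\<close> by auto
    qed
    thus ?thesis using t by simp
  qed
  show ?thesis
  proof (intro equalityI subsetI)
    fix e assume e: "e \<in> R"
    obtain a b where [simp]: "e = (a, b)" by (cases e)
    have "a \<in> V" "b \<in> V" "a \<noteq> b" using e adj_verts adj_irrefl by auto
    moreover have "a = c \<or> b = c" using nb[of a] e \<open>a \<in> V\<close> by auto
    ultimately show "e \<in> {c} \<times> (V - {c}) \<union> (V - {c}) \<times> {c}" by auto
  next
    fix e assume "e \<in> {c} \<times> (V - {c}) \<union> (V - {c}) \<times> {c}"
    thus "e \<in> R" using nb adj_sym by auto
  qed
qed

end

section \<open>Test vectors on two stars and the case of equality\<close>

locale connected_adjacency_spectrum =
  connected_adjacency V R + gram_eigenbasis V "edge_sets R" "\<lambda>v e. of_bool (v \<in> e)" "card V" q p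
  for V :: "'a set" and R q p
begin

text \<open>The edge indicator of a star with centre \<open>c\<close> and leaves \<open>D\<close>.
  The two test vectors are \<open>fan u (nbs u)\<close> and \<open>fan v (nbs v - {u})\<close>;
  leaving out \<open>u\<close> makes them orthogonal even if \<open>u\<close> and \<open>v\<close>
  are adjacent.\<close>

definition fan :: "'a \<Rightarrow> 'a set \<Rightarrow> 'a set \<Rightarrow> real" where
  "fan c D e = of_bool (\<exists>w\<in>D. e = {c, w})"

lemma fan_edge: "fan c D {c, w} = of_bool (w \<in> D)"
  unfolding fan_def by (auto simp: doubleton_eq_iff)

lemma img_eq: "img f v = (\<Sum>w\<in>nbs v. f {v, w})"
  unfolding img_def by (rule sum_incident_edges)

lemma sum_fan_sq:
  assumes "D \<subseteq> nbs c" shows "(\<Sum>e\<in>edge_sets R. (fan c D e)\<^sup>2) = card D"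
proof -
  have "(\<Sum>e\<in>edge_sets R. (fan c D e)\<^sup>2) = (\<Sum>e\<in>edge_sets R. of_bool (c \<in> e) * fan c D e)"
    unfolding fan_def by (rule sum.cong) auto
  also have "\<dots> = (\<Sum>w\<in>nbs c. of_bool (w \<in> D))" unfolding sum_incident_edges fan_edge ..
  also have "\<dots> = card D" using assms finite_nbs by (simp add: Int_absorb1)
  finally show ?thesis .
qed

lemma img_fan:
  assumes "D \<subseteq> nbs c"
  shows "img (fan c D) w = (if w = c then real (card D) else of_bool (w \<in> D))"
proof (cases "w = c")
  case True
  have "img (fan c D) c = (\<Sum>w\<in>nbs c. of_bool (w \<in> D))" unfolding img_eq fan_edge ..
  thus ?thesis using True assms finite_nbs by (simp add: Int_absorb1)
next
  case False
  have "img (fan c D) w = (\<Sum>x\<in>nbs w. if x = c then of_bool (w \<in> D) else 0)"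
    unfolding img_eq fan_def using False by (intro sum.cong) (auto simp: doubleton_eq_iff)
  also have "\<dots> = of_bool (w \<in> D)" using assms adj_sym finite_nbs by auto
  finally show ?thesis using False by simp
qed

text \<open>The image takes the value \<open>card D\<close> at the centre and 1 at each leaf.
  Divided by \<open>sum_fan_sq\<close>, this gives the Rayleigh quotient
  \<open>card D + 1\<close>.\<close>

lemma sum_img_fan_sq:
  assumes "c \<in> V" "D \<subseteq> nbs c"
  shows "(\<Sum>w\<in>V. (img (fan c D) w)\<^sup>2) = real (card D) * (real (card D) + 1)"
proof -
  have "c \<notin> D" "D \<subseteq> V - {c}" using assms adj_irrefl adj_verts by auto
  have "(\<Sum>w\<in>V. (img (fan c D) w)\<^sup>2) = (real (card D))\<^sup>2 + (\<Sum>w\<in>V - {c}. (img (fan c D) w)\<^sup>2)"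
    using assms finite_verts by (simp add: sum.remove[of V c] img_fan)
  also have "(\<Sum>w\<in>V - {c}. (img (fan c D) w)\<^sup>2) = (\<Sum>w\<in>V - {c}. of_bool (w \<in> D))"
    using assms by (intro sum.cong) (auto simp: img_fan)
  also have "(\<Sum>w\<in>V - {c}. of_bool (w \<in> D)) = real (card D)"
    using \<open>D \<subseteq> V - {c}\<close> finite_verts by (simp add: Int_absorb1)
  finally show ?thesis by (simp add: power2_eq_square algebra_simps)
qed

context
  fixes u v :: 'a
  assumes uv: "u \<in> V" "v \<in> V" "u \<noteq> v"
begin

lemma fans_orthogonal: "(\<Sum>e\<in>edge_sets R. fan u (nbs u) e * fan v (nbs v - {u}) e) = 0"
  using uv adj_irrefl by (intro sum.neutral) (auto simp: fan_def doubleton_eq_iff)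

lemma fans_rayleigh:
  assumes "nbs u \<noteq> {}" "nbs v - {u} \<noteq> {}"
  shows "(\<Sum>w\<in>V. (img (fan u (nbs u)) w)\<^sup>2) / (\<Sum>e\<in>edge_sets R. (fan u (nbs u) e)\<^sup>2)
       + (\<Sum>w\<in>V. (img (fan v (nbs v - {u})) w)\<^sup>2) / (\<Sum>e\<in>edge_sets R. (fan v (nbs v - {u}) e)\<^sup>2)
       = real (deg u) + real (card (nbs v - {u})) + 2"
    and "(\<Sum>e\<in>edge_sets R. (fan u (nbs u) e)\<^sup>2) > 0"
    and "(\<Sum>e\<in>edge_sets R. (fan v (nbs v - {u}) e)\<^sup>2) > 0"
proof -
  have "deg u > 0" "card (nbs v - {u}) > 0" using assms finite_nbs by (simp_all add: card_gt_0_iff)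
  thus "(\<Sum>e\<in>edge_sets R. (fan u (nbs u) e)\<^sup>2) > 0" "(\<Sum>e\<in>edge_sets R. (fan v (nbs v - {u}) e)\<^sup>2) > 0"
    "(\<Sum>w\<in>V. (img (fan u (nbs u)) w)\<^sup>2) / (\<Sum>e\<in>edge_sets R. (fan u (nbs u) e)\<^sup>2)
       + (\<Sum>w\<in>V. (img (fan v (nbs v - {u})) w)\<^sup>2) / (\<Sum>e\<in>edge_sets R. (fan v (nbs v - {u}) e)\<^sup>2)
       = real (deg u) + real (card (nbs v - {u})) + 2"
    using uv by (simp_all only: sum_fan_sq sum_img_fan_sq Diff_subset order_refl) simp_all
qed

lemma two_largest_ge_fans:
  assumes "nbs u \<noteq> {}" "nbs v - {u} \<noteq> {}"
  shows "real (deg u) + real (card (nbs v - {u})) + 2 \<le> q 0 + q 1"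
  using two_largest_ge[OF fans_orthogonal fans_rayleigh(2,3)[OF assms]]
  unfolding fans_rayleigh(1)[OF assms] .

text \<open>Equality makes the test pair stationary. Comparing edges at \<open>u\<close> shows that
  \<open>u\<close> and \<open>v\<close> have exactly one common neighbour \<open>w\<close> and no
  other neighbours besides each other; edges missing both \<open>u\<close> and \<open>v\<close> then
  show that \<open>w\<close> has no further neighbour, and connectedness finishes.\<close>

lemma two_largest_eq_fans_imp_triangle:
  assumes adj: "(u, v) \<in> R" and deg: "deg v \<le> deg u" and v: "nbs v - {u} \<noteq> {}"
    and eq: "q 0 + q 1 = real (deg u) + real (card (nbs v - {u})) + 2"
  shows "card V = 3 \<and> R = {(x, y). (x, y) \<in> V \<times> V \<and> x \<noteq> y}"
proof -
  let ?x = "fan u (nbs u)" and ?y = "fan v (nbs v - {u})"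
  have u: "nbs u \<noteq> {}" using adj by auto
  note ray = fans_rayleigh[OF u v]
  \<comment> \<open>The pair is also needed in the opposite order, to vary \<open>?y\<close> instead
    of \<open>?x\<close>.\<close>
  have yx: "(\<Sum>e\<in>edge_sets R. ?y e * ?x e) = 0" using fans_orthogonal by (simp add: mult.commute)
  have uv_eq: "(\<Sum>w\<in>V. (img ?x w)\<^sup>2) / (\<Sum>e\<in>edge_sets R. (?x e)\<^sup>2)
       + (\<Sum>w\<in>V. (img ?y w)\<^sup>2) / (\<Sum>e\<in>edge_sets R. (?y e)\<^sup>2) = q 0 + q 1"
    using ray(1) eq by simp
  hence vu_eq: "(\<Sum>w\<in>V. (img ?y w)\<^sup>2) / (\<Sum>e\<in>edge_sets R. (?y e)\<^sup>2)
       + (\<Sum>w\<in>V. (img ?x w)\<^sup>2) / (\<Sum>e\<in>edge_sets R. (?x e)\<^sup>2) = q 0 + q 1" by simp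
  have v_sub: "nbs v - {u} \<subseteq> nbs v" by auto
  have vu: "(v, u) \<in> R" using adj_sym[OF adj] .
  have other: "card (nbs v - {u}) = 1 \<and> (w, v) \<in> R" if w: "(u, w) \<in> R" "w \<noteq> v" for w
  proof -
    \<comment> \<open>On both edges \<open>{u, v}\<close> and \<open>{u, w}\<close> the vector
      \<open>?x\<close> is 1 and \<open>?y\<close> is 0. The image of \<open>?y\<close> is
      \<open>card (nbs v - {u})\<close> at \<open>v\<close> and at most 1 at
      \<open>w\<close>.\<close>
    have "img ?y u + img ?y v = img ?y u + img ?y w"
      using two_largest_eq_gram_cong[OF yx ray(3,2) vu_eq edge_setsI[OF adj] edge_setsI[OF w(1)]] w adj uv
      unfolding sum_edge_ends[OF adj] sum_edge_ends[OF w(1)]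
      by (simp add: fan_edge) (auto simp: fan_def doubleton_eq_iff)
    hence "real (card (nbs v - {u})) = of_bool (w \<in> nbs v - {u})"
      using w by (simp add: img_fan[OF v_sub])
    moreover have "card (nbs v - {u}) > 0" using v finite_nbs by (simp add: card_gt_0_iff)
    ultimately show ?thesis using adj_sym by (cases "w \<in> nbs v - {u}") auto
  qed
  have no_edge: "(w, u) \<notin> R" if e: "(w, t) \<in> R" "w \<notin> {u, v}" "t \<notin> {u, v}" for w t
  proof -
    \<comment> \<open>Both test vectors vanish on an edge missing \<open>u\<close> and
      \<open>v\<close>; the two summands are nonnegative, so each is 0.\<close>
    have "img ?x w + img ?x t = 0"
      using two_largest_eq_gram_zero[OF fans_orthogonal ray(2,3) uv_eq edge_setsI[OF e(1)]] e
      unfolding sum_edge_ends[OF e(1)] by (auto simp: fan_def doubleton_eq_iff)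
    hence "w \<notin> nbs u" using e by (cases "t \<in> nbs u") (auto simp: img_fan split: if_splits)
    thus ?thesis using adj_sym by auto
  qed
  have deg_v: "deg v = Suc (card (nbs v - {u}))"
    using vu finite_nbs by (metis ImageI card.remove insertI1)
  \<comment> \<open>Here the choice of \<open>u\<close> as the vertex of larger degree enters:
    \<open>v\<close> has a second neighbour, so \<open>u\<close> has one too.\<close>
  have "nbs u \<noteq> {v}"
  proof
    assume "nbs u = {v}"
    hence "card (nbs v - {u}) = 0" using deg deg_v by simp
    thus False using v finite_nbs by simp
  qed
  then obtain w where w: "(u, w) \<in> R" "w \<noteq> v" using adj by auto
  have wv: "(w, v) \<in> R" "w \<noteq> u" using other[OF w] w adj_irrefl by auto
  have "card (nbs v - {u}) = 1" using other[OF w] by simp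
  moreover have "w \<in> nbs v - {u}" using wv adj_sym by auto
  ultimately have "nbs v - {u} = {w}" by (metis card_1_singletonE singletonD)
  hence nv: "nbs v = {u, w}" using vu by auto
  have nu: "nbs u = {v, w}"
  proof (intro equalityI subsetI)
    fix t assume "t \<in> nbs u"
    hence t: "(u, t) \<in> R" by simp
    show "t \<in> {v, w}"
    proof (cases "t = v")
      case False
      hence "t \<in> nbs v" using other[OF t] adj_sym by auto
      thus ?thesis using nv t adj_irrefl by auto
    qed simp
  qed (use w adj in auto)
  have nw: "nbs w = {u, v}"
  proof (intro equalityI subsetI)
    fix t assume "t \<in> nbs w"
    hence t: "(w, t) \<in> R" by simp
    show "t \<in> {u, v}" using no_edge[OF t] w wv adj_sym by auto
  qed (use w wv adj_sym in auto)
  have "{u, v, w} = V"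
    using nu nv nw uv adj_verts w by (intro closed_eq_verts) auto
  hence V: "V = {u, v, w}" ..
  have "card V = 3" unfolding V using uv w wv by simp
  moreover have "R = {(x, y). (x, y) \<in> V \<times> V \<and> x \<noteq> y}"
  proof -
    have "u \<noteq> w" "v \<noteq> w" using w wv by auto
    hence "nbs u = V - {u}" "nbs v = V - {v}" "nbs w = V - {w}"
      unfolding nu nv nw V using uv(3) by auto
    hence nbs: "nbs x = V - {x}" if "x \<in> V" for x using that V by blast
    have "(x, y) \<in> R \<longleftrightarrow> (x, y) \<in> V \<times> V \<and> x \<noteq> y" for x y
      using nbs[of x] adj_verts by blast
    thus ?thesis by auto
  qed
  ultimately show ?thesis ..
qed

end

section \<open>Spectra of the triangle and the stars\<close>

lemma vertex_eigen:
  "i < card V \<Longrightarrow> v \<in> V \<Longrightarrow> q i * p i v = (\<Sum>w\<in>nbs v. p i v + p i w)"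
  using eigen[of i v] unfolding gram_edge_sets by (rule sym)

lemma sum_eigenvalues_deg: "(\<Sum>i<card V. q i) = (\<Sum>v\<in>V. real (deg v))"
proof -
  have "(\<Sum>e\<in>edge_sets R. (of_bool (v \<in> e))\<^sup>2) = real (deg v)" for v
  proof -
    have "(\<Sum>e\<in>edge_sets R. (of_bool (v \<in> e))\<^sup>2) = (\<Sum>e\<in>edge_sets R. of_bool (v \<in> e) * 1 :: real)"
      by (rule sum.cong) auto
    thus ?thesis unfolding sum_incident_edges by simp
  qed
  thus ?thesis unfolding sum_eigenvalues by simp
qed

text \<open>An eigenvector with entry sum \<open>S\<close> satisfies \<open>q i * S = 4 * S\<close>;
  hence the eigenvalue is 4, or \<open>S = 0\<close> and it is 1. The trace 6 leaves only the
  spectrum 4, 1, 1.\<close>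

lemma triangle_two_largest:
  assumes V: "card V = 3" and R: "R = {(x, y). (x, y) \<in> V \<times> V \<and> x \<noteq> y}"
  shows "q 0 + q 1 = 5"
proof -
  have nbs: "nbs v = V - {v}" if "v \<in> V" for v unfolding R using that by auto
  have "(\<Sum>v\<in>V. real (deg v)) = (\<Sum>v\<in>V. 2)"
    using V nbs finite_verts by (intro sum.cong) auto
  hence "(\<Sum>i<card V. q i) = 6"
    unfolding sum_eigenvalues_deg using V by simp
  hence sum: "q 0 + q 1 + q 2 = 6" unfolding V by (simp add: numeral_3_eq_3 numeral_2_eq_2)
  have "q i = 1 \<or> q i = 4" if i: "i < card V" for i
  proof (rule disjCI)
    assume "q i \<noteq> 4"
    define S where "S = (\<Sum>v\<in>V. p i v)"
    have pS: "q i * p i v = p i v + S" if "v \<in> V" for v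
    proof -
      have "q i * p i v = 2 * p i v + (\<Sum>w\<in>V - {v}. p i w)"
        using vertex_eigen[OF i that] that V finite_verts unfolding nbs[OF that]
        by (simp add: sum.distrib)
      also have "(\<Sum>w\<in>V - {v}. p i w) = S - p i v"
        unfolding S_def using that finite_verts by (simp add: sum_diff1)
      finally show ?thesis by simp
    qed
    have "q i * S = (\<Sum>v\<in>V. q i * p i v)" by (simp add: S_def sum_distrib_left)
    also have "\<dots> = (\<Sum>v\<in>V. p i v + S)" by (rule sum.cong[OF refl pS])
    also have "\<dots> = 4 * S" using V by (simp add: sum.distrib S_def[symmetric])
    finally have "S = 0" using \<open>q i \<noteq> 4\<close> by simp
    thus "q i = 1" using pS eigenvector_nonzero[OF i] by auto
  qed
  hence "q 0 = 1 \<or> q 0 = 4" "q 1 = 1 \<or> q 1 = 4" "q 2 = 1 \<or> q 2 = 4" unfolding V by auto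
  moreover have "q 1 \<le> q 0" "q 2 \<le> q 1" using decreasing[of 0 1] decreasing[of 1 2] unfolding V by auto
  ultimately show ?thesis using sum by auto
qed

lemma star_deg:
  assumes "c \<in> V" and "R = {c} \<times> (V - {c}) \<union> (V - {c}) \<times> {c}" and "v \<in> V"
  shows "deg v = (if v = c then card V - 1 else 1)"
proof -
  have "nbs v = (if v = c then V - {c} else {c})" using assms by auto
  thus ?thesis using assms(1) finite_verts by simp
qed

text \<open>For an eigenvalue other than 1, the leaf equations determine the leaf entries from
  \<open>p i c\<close>, which is therefore nonzero. Substituting them into the equation at the
  centre gives \<open>q i * (q i - card V) = 0\<close>.\<close>

lemma star_eigenvalue:
  assumes c: "c \<in> V" and R: "R = {c} \<times> (V - {c}) \<union> (V - {c}) \<times> {c}" and i: "i < card V"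
  shows "q i \<in> {0, 1, real (card V)}"
proof (cases "q i = 1")
  case False
  let ?S = "\<Sum>w\<in>V - {c}. p i w"
  have nc: "nbs c = V - {c}" and nl: "\<And>w. w \<in> V - {c} \<Longrightarrow> nbs w = {c}" using c R by auto
  have "card V \<ge> 1" using i by simp
  have center: "q i * p i c = (card V - 1) * p i c + ?S"
    using vertex_eigen[OF i c] c finite_verts unfolding nc by (simp add: sum.distrib)
  have leaf: "(q i - 1) * p i w = p i c" if "w \<in> V - {c}" for w
    using vertex_eigen[OF i, of w] that nl[OF that] by (simp add: left_diff_distrib)
  have "(q i - 1) * ?S = (card V - 1) * p i c"
    unfolding sum_distrib_left using leaf c finite_verts by simp
  moreover have "?S = (q i - (card V - 1)) * p i c" using center by (simp add: left_diff_distrib)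
  ultimately have "((q i - 1) * (q i - (card V - 1)) - (card V - 1)) * p i c = 0"
    by (simp add: left_diff_distrib mult.assoc)
  moreover have "(q i - 1) * (q i - (card V - 1)) - (card V - 1) = q i * (q i - card V)"
    using \<open>card V \<ge> 1\<close> by (simp add: of_nat_diff algebra_simps)
  moreover have "p i c \<noteq> 0"
  proof
    assume "p i c = 0"
    hence "p i w = 0" if "w \<in> V" for w using leaf[of w] that False by (cases "w = c") auto
    thus False using eigenvector_nonzero[OF i] by blast
  qed
  ultimately show ?thesis by auto
qed simp

text \<open>With possible eigenvalues 0, 1 and n = \<open>card V\<close>, the trace 2n - 2 decides:
  without n it would be at most n, with n twice at least 2n, and with \<open>q 1 = 0\<close> only n.
  So \<open>q 0\<close> is n and \<open>q 1\<close> is 1.\<close>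

lemma star_two_largest:
  assumes c: "c \<in> V" and R: "R = {c} \<times> (V - {c}) \<union> (V - {c}) \<times> {c}" and n: "card V \<ge> 3"
  shows "q 0 + q 1 = real (card V) + 1"
proof -
  have n01: "0 < card V" "1 < card V" using n by auto
  have "(\<Sum>i<card V. q i) = (\<Sum>v\<in>V. if v = c then real (card V - 1) else 1)"
    unfolding sum_eigenvalues_deg using star_deg[OF c R] by (intro sum.cong) auto
  also have "\<dots> = real (card V - 1) + (\<Sum>v\<in>V - {c}. 1)"
    using c finite_verts by (subst sum.remove[of V c]) auto
  also have "\<dots> = 2 * real (card V) - 2"
    using c finite_verts n by (simp add: of_nat_diff)
  finally have sum: "(\<Sum>i<card V. q i) = 2 * real (card V) - 2" .
  note ev = star_eigenvalue[OF c R]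
  have "q 0 = card V"
  proof (rule ccontr)
    assume "q 0 \<noteq> card V"
    hence "q 0 \<le> 1" using ev[OF n01(1)] by auto
    hence "q i \<le> 1" if "i < card V" for i using decreasing[of 0 i] that by simp
    hence "(\<Sum>i<card V. q i) \<le> (\<Sum>i<card V. 1)" by (intro sum_mono) auto
    thus False using sum n by simp
  qed
  moreover have "q 1 \<noteq> card V"
  proof
    assume "q 1 = card V"
    moreover have "(\<Sum>i\<in>{0, 1}. q i) \<le> (\<Sum>i<card V. q i)"
      using n01 eigenvalue_nonneg by (intro sum_mono2) auto
    ultimately show False using sum \<open>q 0 = card V\<close> by simp
  qed
  moreover have "q 1 \<noteq> 0"
  proof
    assume "q 1 = 0"
    have "(\<Sum>i<card V. q i) \<le> (\<Sum>i<card V. if i = 0 then q 0 else 0)"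
    proof (rule sum_mono)
      fix i assume "i \<in> {..<card V}"
      thus "q i \<le> (if i = 0 then q 0 else 0)" using decreasing[of 1 i] \<open>q 1 = 0\<close> by (cases i) auto
    qed
    thus False using sum n \<open>q 0 = card V\<close> by simp
  qed
  ultimately show ?thesis using ev[OF n01(2)] by auto
qed

text \<open>The theorem for vertices \<open>u\<close>, \<open>v\<close> realising the two largest
  degrees, split by whether \<open>deg v\<close> is 1 and whether \<open>u\<close> and
  \<open>v\<close> are adjacent.\<close>

lemma two_largest_ge_deg:
  assumes n: "card V \<ge> 3" and uv: "u \<in> V" "v \<in> V" "u \<noteq> v" and "deg v \<le> deg u"
    and others: "\<And>w. w \<in> V \<Longrightarrow> w \<noteq> u \<Longrightarrow> deg w \<le> deg v"
  shows "q 0 + q 1 \<ge> real (deg u) + real (deg v) + 1 \<and>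
    (q 0 + q 1 = real (deg u) + real (deg v) + 1 \<longleftrightarrow>
      card V = 3 \<and> R = {(x, y). (x, y) \<in> V \<times> V \<and> x \<noteq> y} \<or>
      (\<exists>c\<in>V. R = {c} \<times> (V - {c}) \<union> (V - {c}) \<times> {c}))"
    (is "_ \<and> (_ \<longleftrightarrow> ?K3 \<or> ?star)")
proof -
  have ne: "nbs w \<noteq> {}" if "w \<in> V" for w using nbs_nonempty that n by simp
  have star_eq: "q 0 + q 1 = real (deg u) + real (deg v) + 1" if star: ?star
  proof -
    obtain c where c: "c \<in> V" and R: "R = {c} \<times> (V - {c}) \<union> (V - {c}) \<times> {c}" using star by blast
    note d = star_deg[OF c R]
    \<comment> \<open>Otherwise \<open>deg u\<close> would be 1 and yet at least
      \<open>deg c\<close>, which is \<open>card V - 1\<close>.\<close>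
    have "u = c"
    proof (rule ccontr)
      assume "u \<noteq> c"
      hence "deg c \<le> deg u" using others[of c] \<open>deg v \<le> deg u\<close> c by simp
      thus False using d[OF c] d[OF uv(1)] \<open>u \<noteq> c\<close> n by simp
    qed
    hence "deg u = card V - 1" "deg v = 1" using d uv by auto
    thus ?thesis using star_two_largest[OF c R n] n by (simp only: of_nat_diff)
  qed
  have K3_eq: "q 0 + q 1 = real (deg u) + real (deg v) + 1" if ?K3
  proof -
    have "nbs u = V - {u}" "nbs v = V - {v}" using that uv by auto
    thus ?thesis using triangle_two_largest that uv finite_verts by simp
  qed
  show ?thesis
  proof (cases "deg v \<ge> 2")
    case False
    hence "deg w = 1" if "w \<in> V" "w \<noteq> u" for w
    proof -
      have "deg w > 0" using ne[OF that(1)] finite_nbs by (simp add: card_gt_0_iff)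
      thus ?thesis using others[OF that] False by linarith
    qed
    hence ?star using all_other_deg_1_imp_star[OF uv(1)] uv(1) by blast
    thus ?thesis using star_eq by simp
  next
    case True
    show ?thesis
    proof (cases "(u, v) \<in> R")
      case adj: True
      have "deg v = Suc (card (nbs v - {u}))"
        using adj_sym[OF adj] finite_nbs by (metis ImageI card.remove insertI1)
      hence deg_v: "real (deg v) = real (card (nbs v - {u})) + 1" and v: "nbs v - {u} \<noteq> {}"
        using True by (simp, metis Suc_n_not_le_n card.empty numeral_2_eq_2)
      have "q 0 + q 1 \<ge> real (deg u) + real (deg v) + 1"
        using two_largest_ge_fans[OF uv ne[OF uv(1)] v] deg_v by linarith
      moreover have ?K3 if "q 0 + q 1 = real (deg u) + real (deg v) + 1"
        using two_largest_eq_fans_imp_triangle[OF uv adj \<open>deg v \<le> deg u\<close> v] that deg_v by linarith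
      ultimately show ?thesis using star_eq K3_eq by blast
    next
      \<comment> \<open>For nonadjacent \<open>u\<close>, \<open>v\<close> the bound is larger by 1,
        so equality fails; as triangles and stars would attain equality, they are excluded as
        well.\<close>
      case False
      hence "nbs v - {u} = nbs v" using adj_sym by blast
      hence "q 0 + q 1 \<ge> real (deg u) + real (deg v) + 2"
        using two_largest_ge_fans[OF uv ne[OF uv(1)]] ne[OF uv(2)] by simp
      thus ?thesis using star_eq K3_eq by auto
    qed
  qed
qed

end

section \<open>Transfer to digraphs and their matrices\<close>

lemma (in graph) connected_adjacency_verts:
  assumes "Digraph_Component.connected G"
  shows "connected_adjacency (verts G) (arcs_ends G)"
proof
  show "finite (verts G)" by simp
  show "arcs_ends G \<subseteq> verts G \<times> verts G" using adj_in_verts by auto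
  show "(w, v) \<in> arcs_ends G" if "(v, w) \<in> arcs_ends G" for v w
    using that sym_arcs by (rule arcs_ends_symmetric[rotated])
  show "(v, v) \<notin> arcs_ends G" for v using adj_not_same by blast
  fix S assume S: "S \<subseteq> verts G" "S \<noteq> {}" "\<And>v w. v \<in> S \<Longrightarrow> (v, w) \<in> arcs_ends G \<Longrightarrow> w \<in> S"
  then obtain x where x: "x \<in> S" by blast
  have "v \<in> S" if "v \<in> verts G" for v
  proof -
    have "x \<rightarrow>\<^sup>*\<^bsub>mk_symmetric G\<^esub> v"
      using assms S x that unfolding connected_def strongly_connected_def by auto
    hence "x \<rightarrow>\<^sup>* v" using reachable_mk_symmetric_eq[OF sym_arcs] by simp
    thus ?thesis by (induction rule: reachable_induct) (use x S in auto)
  qed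
  thus "S = verts G" using S by blast
qed

lemma (in nomulti_digraph) out_degree_eq_card_nbs: "out_degree G v = card (arcs_ends G `` {v})"
proof -
  have "arcs_ends G `` {v} = head G ` out_arcs G v"
    unfolding arcs_ends_conv by auto
  moreover have "inj_on (head G) (out_arcs G v)"
    using no_multi_arcs by (auto simp: inj_on_def arc_to_ends_def)
  ultimately show ?thesis unfolding out_degree_def by (simp add: card_image)
qed

lemma (in digraph) signless_laplacian_index:
  assumes "distinct vs" "k < length vs" "l < length vs"
  shows "signless_laplacian G vs $$ (k, l)
    = of_bool (k = l) * real (out_degree G (vs ! k)) + of_bool ((vs ! k, vs ! l) \<in> arcs_ends G)"
  using assms unfolding signless_laplacian_def degree_mat_def adjacency_mat_def mat_diag_def by auto

text \<open>The eigenbasis of the matrix lives on positions in \<open>vs\<close> and is carried over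
  to the vertices. The \<open>Suc\<close> reconciles eigenvalues numbered from 1 with the numbering
  from 0 in the locale.\<close>

lemma (in graph) signless_laplacian_spectrum:
  assumes conn: "Digraph_Component.connected G" and card: "card (verts G) \<ge> 3"
    and vs: "distinct vs" "set vs = verts G"
  shows "\<exists>p. connected_adjacency_spectrum (verts G) (arcs_ends G) (\<lambda>i. signless_eigenvalue G vs (Suc i)) p"
proof -
  interpret A: connected_adjacency "verts G" "arcs_ends G"
    using connected_adjacency_verts[OF conn] .
  let ?n = "length vs" and ?Q = "signless_laplacian G vs"
  let ?es = "rev (sorted_list_of_multiset (proots (char_poly ?Q)))"
  have n: "?n = card (verts G)" using distinct_card[OF vs(1)] vs(2) by simp
  have Q: "?Q \<in> carrier_mat ?n ?n"
    unfolding signless_laplacian_def degree_mat_def adjacency_mat_def by simp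
  have "?Q\<^sup>T = ?Q"
    by (rule eq_matI)
      (use Q A.adj_sym in \<open>auto simp: signless_laplacian_index[OF vs(1)]\<close>)
  from symmetric_mat_eigenbasis[OF Q this, of ?es] obtain p where len: "length ?es = ?n"
    and p: "\<And>i j. i < ?n \<Longrightarrow> j < ?n \<Longrightarrow> (\<Sum>k<?n. p i k * p j k) = of_bool (i = j)"
      "\<And>k l. k < ?n \<Longrightarrow> l < ?n \<Longrightarrow> (\<Sum>i<?n. p i k * p i l) = of_bool (k = l)"
      "\<And>i k. i < ?n \<Longrightarrow> k < ?n \<Longrightarrow> (\<Sum>l<?n. ?Q $$ (k, l) * p i l) = ?es ! i * p i k"
    by auto
  have es: "signless_eigenvalue G vs (Suc i) = ?es ! i" for i
    unfolding signless_eigenvalue_def kth_largest_def by simp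
  have bij: "bij_betw ((!) vs) {..<?n} (verts G)" using bij_betw_nth[OF vs(1)] vs(2) by blast
  \<comment> \<open>The position of a vertex in \<open>vs\<close>, used to read a vector entry at a
    vertex.\<close>
  define idx where "idx = the_inv_into {..<?n} ((!) vs)"
  have idx: "idx (vs ! k) = k" if "k < ?n" for k
    unfolding idx_def using that bij by (intro the_inv_into_f_f) (auto simp: bij_betw_def)
  have sum_verts: "(\<Sum>v\<in>verts G. g v) = (\<Sum>k<?n. g (vs ! k))" for g :: "'a \<Rightarrow> real"
    using sum.reindex_bij_betw[OF bij, of g] by simp
  have nth_idx: "\<exists>k<?n. v = vs ! k" if "v \<in> verts G" for v
    using that vs(2) by (metis in_set_conv_nth)
  have "connected_adjacency_spectrum (verts G) (arcs_ends G) (\<lambda>i. ?es ! i) (\<lambda>i v. p i (idx v))"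
  proof (intro connected_adjacency_spectrum.intro gram_eigenbasis.intro)
    show "connected_adjacency (verts G) (arcs_ends G)" using connected_adjacency_verts[OF conn] .
    show "finite (verts G)" by simp
    show "finite (edge_sets (arcs_ends G))" by (rule A.finite_edge_sets)
    show "2 \<le> card (verts G)" using card by simp
    show "?es ! j \<le> ?es ! i" if "i \<le> j" "j < card (verts G)" for i j
      using that len n by (intro sorted_rev_nth_mono) auto
    show "(\<Sum>v\<in>verts G. p i (idx v) * p j (idx v)) = of_bool (i = j)"
      if "i < card (verts G)" "j < card (verts G)" for i j
      unfolding sum_verts using p(1)[of i j] idx that n by simp
    show "(\<Sum>i<card (verts G). p i (idx v) * p i (idx w)) = of_bool (v = w)"
      if vw: "v \<in> verts G" "w \<in> verts G" for v w
    proof -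
      obtain k l where kl: "k < ?n" "v = vs ! k" "l < ?n" "w = vs ! l" using nth_idx vw by blast
      thus ?thesis using p(2)[OF kl(1,3)] n idx vs(1) by (simp add: nth_eq_iff_index_eq)
    qed
    show "(\<Sum>e\<in>edge_sets (arcs_ends G). of_bool (v \<in> e) * (\<Sum>w\<in>verts G. of_bool (w \<in> e) * p i (idx w)))
        = ?es ! i * p i (idx v)" if i: "i < card (verts G)" and v: "v \<in> verts G" for i v
    proof -
      obtain k where k: "k < ?n" "v = vs ! k" using nth_idx v by blast
      \<comment> \<open>By \<open>gram_edge_sets\<close> this is the left side of the goal; it is
        now matched with row \<open>k\<close> of the matrix times the eigenvector.\<close>
      have "(\<Sum>w\<in>A.nbs v. p i (idx v) + p i (idx w))
          = real (out_degree G v) * p i k + (\<Sum>w\<in>A.nbs v. p i (idx w))"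
        using k idx by (simp add: sum.distrib out_degree_eq_card_nbs)
      also have "(\<Sum>w\<in>A.nbs v. p i (idx w)) = (\<Sum>w\<in>verts G. of_bool ((v, w) \<in> arcs_ends G) * p i (idx w))"
        using A.adj_verts by (intro sum.mono_neutral_cong_left) auto
      also have "\<dots> = (\<Sum>l<?n. of_bool ((vs ! k, vs ! l) \<in> arcs_ends G) * p i l)"
        unfolding sum_verts using k idx by simp
      also have "real (out_degree G v) * p i k + \<dots> = (\<Sum>l<?n. ?Q $$ (k, l) * p i l)"
      proof -
        have "(\<Sum>l<?n. of_bool (k = l) * real (out_degree G (vs ! k)) * p i l)
            = (\<Sum>l<?n. if l = k then real (out_degree G v) * p i k else 0)"
          using k by (intro sum.cong) auto
        thus ?thesis using k
          by (simp add: signless_laplacian_index[OF vs(1)] distrib_right sum.distrib)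
      qed
      also have "\<dots> = ?es ! i * p i (idx v)" using p(3)[of i k] i n k idx by simp
      finally show ?thesis unfolding A.gram_edge_sets .
    qed
  qed
  thus ?thesis unfolding es by blast
qed

text \<open>Sorting the elements of \<open>V\<close> themselves by \<open>d\<close>, rather than
  only their values, yields two distinct witnesses even when the two largest values
  coincide.\<close>

lemma kth_largest_image_mset_set:
  fixes d :: "'a \<Rightarrow> 'b :: linorder"
  assumes V: "finite V" "card V \<ge> 2"
  obtains u v where "u \<in> V" "v \<in> V" "u \<noteq> v"
    "kth_largest (image_mset d (mset_set V)) 1 = d u" "kth_largest (image_mset d (mset_set V)) 2 = d v"
    "d v \<le> d u" "\<And>w. w \<in> V \<Longrightarrow> w \<noteq> u \<Longrightarrow> d w \<le> d v"
proof -
  obtain xs where xs: "set xs = V" "distinct xs" using finite_distinct_list[OF V(1)] by blast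
  define ys where "ys = rev (sort_key d xs)"
  have ys: "set ys = V" "distinct ys" unfolding ys_def using xs by auto
  have len: "length ys \<ge> 2" using V distinct_card[OF ys(2)] ys(1) by simp
  have "mset_set V = mset xs" using mset_set_set[OF xs(2)] xs(1) by simp
  hence "image_mset d (mset_set V) = mset (map d xs)" by simp
  moreover have "sorted_list_of_multiset (mset (map d xs)) = map d (sort_key d xs)"
    unfolding sorted_list_of_multiset_mset by (rule properties_for_sort) auto
  ultimately have kth: "kth_largest (image_mset d (mset_set V)) k = map d ys ! (k - 1)" for k
    unfolding kth_largest_def ys_def by (simp add: rev_map)
  have sorted: "sorted (rev (map d ys))" unfolding ys_def rev_map rev_rev_ident by simp
  have mono: "d (ys ! j) \<le> d (ys ! i)" if "i \<le> j" "j < length ys" for i j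
    using sorted_rev_nth_mono[OF sorted that(1)] that by simp
  show ?thesis
  proof (rule that[of "ys ! 0" "ys ! 1"])
    have less: "0 < length ys" "1 < length ys" using len by linarith+
    thus "ys ! 0 \<in> V" "ys ! 1 \<in> V" unfolding ys(1)[symmetric] using nth_mem[of 0 ys] nth_mem[of 1 ys] by blast+
    show "ys ! 0 \<noteq> ys ! 1" using nth_eq_iff_index_eq[OF ys(2) less] by simp
    show "kth_largest (image_mset d (mset_set V)) 1 = d (ys ! 0)"
      "kth_largest (image_mset d (mset_set V)) 2 = d (ys ! 1)" unfolding kth using nth_map[OF less(1), of d] nth_map[OF less(2), of d] by simp_all
    show "d (ys ! 1) \<le> d (ys ! 0)" using mono[OF _ less(2), of 0] by simp
    fix w assume w: "w \<in> V" "w \<noteq> ys ! 0"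
    then obtain i where i: "i < length ys" "w = ys ! i" using ys(1) by (metis in_set_conv_nth)
    hence "1 \<le> i" using w by (cases i) auto
    thus "d w \<le> d (ys ! 1)" using mono i by simp
  qed
qed

lemma (in graph) is_graph: "graph G"
  by unfold_locales

text \<open>The one-element side of the bipartition is the centre of the star.\<close>

lemma (in graph) complete_bipartite_digraph_1:
  "complete_bipartite_digraph 1 (card (verts G) - 1) G
    \<longleftrightarrow> (\<exists>c\<in>verts G. arcs_ends G = {c} \<times> (verts G - {c}) \<union> (verts G - {c}) \<times> {c})"
proof
  assume "complete_bipartite_digraph 1 (card (verts G) - 1) G"
  then obtain U W where "verts G = U \<union> W" "U \<inter> W = {}" "card U = 1" "arcs_ends G = U \<times> W \<union> W \<times> U"
    unfolding complete_bipartite_digraph_def by blast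
  moreover from this obtain c where "U = {c}" using card_1_singletonE by blast
  ultimately have "c \<in> verts G" "W = verts G - {c}" "U = {c}" by auto
  thus "\<exists>c\<in>verts G. arcs_ends G = {c} \<times> (verts G - {c}) \<union> (verts G - {c}) \<times> {c}"
    using \<open>arcs_ends G = _\<close> by blast
next
  assume "\<exists>c\<in>verts G. arcs_ends G = {c} \<times> (verts G - {c}) \<union> (verts G - {c}) \<times> {c}"
  then obtain c where c: "c \<in> verts G"
    and arcs: "arcs_ends G = {c} \<times> (verts G - {c}) \<union> (verts G - {c}) \<times> {c}" by blast
  have "verts G = {c} \<union> (verts G - {c})" "{c} \<inter> (verts G - {c}) = {}" "card (verts G - {c}) = card (verts G) - 1"
    using c by auto
  moreover have "card {c} = 1" by simp
  ultimately show "complete_bipartite_digraph 1 (card (verts G) - 1) G"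
    unfolding complete_bipartite_digraph_def using arcs is_graph by blast
qed

theorem theorem3p7:
  fixes G :: "('a, 'b) pre_digraph" and vs :: "'a list"
  assumes "Digraph.graph G"
    and "Digraph_Component.connected G"
    and "card (verts G) \<ge> 3"
    and "distinct vs" and "set vs = verts G"
  shows "signless_eigenvalue G vs 1 + signless_eigenvalue G vs 2
           \<ge> real (degree_seq G 1) + real (degree_seq G 2) + 1
         \<and> (signless_eigenvalue G vs 1 + signless_eigenvalue G vs 2
              = real (degree_seq G 1) + real (degree_seq G 2) + 1
            \<longleftrightarrow> complete_digraph 3 G \<or> complete_bipartite_digraph 1 (card (verts G) - 1) G)"
proof -
  interpret graph G by fact
  obtain p where "connected_adjacency_spectrum (verts G) (arcs_ends G) (\<lambda>i. signless_eigenvalue G vs (Suc i)) p"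
    using signless_laplacian_spectrum[OF assms(2-5)] by blast
  then interpret connected_adjacency_spectrum "verts G" "arcs_ends G" "\<lambda>i. signless_eigenvalue G vs (Suc i)" p .
  obtain u v where uv: "u \<in> verts G" "v \<in> verts G" "u \<noteq> v"
    and seq: "degree_seq G 1 = deg u" "degree_seq G 2 = deg v"
    and le: "deg v \<le> deg u" "\<And>w. w \<in> verts G \<Longrightarrow> w \<noteq> u \<Longrightarrow> deg w \<le> deg v"
    using kth_largest_image_mset_set[of "verts G" "out_degree G"] assms(3)
    unfolding degree_seq_def out_degree_eq_card_nbs by auto
  have "complete_digraph 3 G \<longleftrightarrow> card (verts G) = 3 \<and> arcs_ends G = {(x, y). (x, y) \<in> verts G \<times> verts G \<and> x \<noteq> y}"
    unfolding complete_digraph_def using is_graph by blast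
  thus ?thesis
    using two_largest_ge_deg[OF assms(3) uv le] unfolding seq complete_bipartite_digraph_1
    by (simp add: numeral_2_eq_2)
qed

end
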